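(* For every positive real number $\alpha$ and every positive integer $n$, $\mathbb{E}^n \not\to (\ell_3, \alpha\ell_{6889})$; that is, there is a red/blue coloring of $\mathbb{E}^n$ with no red congruent copy of $\ell_3$ and no blue congruent copy of $\alpha\ell_{6889}$.
   Context: $\mathbb{E}^n$ denotes $\mathbb{R}^n$ with the Euclidean norm. For a real $\alpha>0$ and integer $m\ge2$, $\alpha\ell_m$ denotes $m$ collinear points with consecutive points at distance $\alpha$; a congruent copy of it in $\mathbb{E}^n$ is a set $\{x_0,x_0+\alpha u,\dots,x_0+(m-1)\alpha u\}$ with $x_0\in\mathbb{E}^n$, $|u|=1$. We write $\ell_m=1\ell_m$. The notation $\mathbb{E}^n\not\to(K_1,K_2)$ means there is a two-coloring (red/blue) of $\mathbb{E}^n$ with no red congruent copy of $K_1$ and no blue congruent copy of $K_2$. *)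

theory Defs
  imports "HOL-Analysis.Analysis"
begin

datatype colour = Red | Blue

(* The congruent copies of \<alpha> \<ell>_m in E^n:
   the sets {x, x + \<alpha> u, ..., x + (m - 1) \<alpha> u} with |u| = 1. *)
definition ell_copies :: "real \<Rightarrow> nat \<Rightarrow> (real ^ 'n) set set" where
  "ell_copies \<alpha> m =
     {(\<lambda>i. x + (real i * \<alpha>) *\<^sub>R u) ` {..<m} | x u. norm u = 1}"

(* E^n \<not>\<rightarrow> (K1, K2); each configuration K is represented by the family of all
   its congruent copies in E^n. *)
definition not_arrow :: "(real ^ 'n) set set \<Rightarrow> (real ^ 'n) set set \<Rightarrow> bool" where
  "not_arrow copies1 copies2 \<longleftrightarrow>
     (\<exists>c :: real ^ 'n \<Rightarrow> colour.
        \<not> (\<exists>S \<in> copies1. \<forall>x \<in> S. c x = Red) \<and>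
        \<not> (\<exists>S \<in> copies2. \<forall>x \<in> S. c x = Blue))"

end

(* Colour x red iff frac (\<sigma> |x|^2) < \<delta>. Along a line with step \<beta> the value \<sigma> |x|^2 is a
   quadratic polynomial with leading coefficient \<sigma> \<beta>^2. For \<ell>_3 its second difference 2 \<sigma> must stay
   at distance at least 2 \<delta> from the integers. For \<alpha> \<ell>_6889 the number \<sigma> \<alpha>^2 is chosen to be (close
   to) a fraction a/q with q a small prime: an approximation J b q = e + D with J <= 5 handles the
   linear coefficient b. If |D| >= 1/n, the values along i = q J j move modulo 1 in steps D and
   sweep through the circle; if |D| < 1/n, the values along i = J s are almost those of a quadratic
   polynomial modulo q, whose gaps on the circle are short.

   If 2 / (\<alpha>^2 q) is not an integer for some prime q in {67, 71, 73, 79, 83}, multiplying it by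
   a power of 2 takes it to distance at least 1/3 from the integers, so a = 2^k, \<delta> = 1/6 works.
   Otherwise 2 / \<alpha>^2 is a multiple of the product of these primes, hence so large that
   \<sigma> \<alpha>^2 = 1/83 + \<alpha>^2/4 is close enough to 1/83 for \<delta> = 1/4. *)
theory Submission
  imports Defs "HOL-Number_Theory.Cong" "HOL-Computational_Algebra.Primes"
begin

section \<open>Colouring by the fractional part of a multiple of the squared norm\<close>

lemma frac_less_if_near_int:
  fixes x \<delta> :: real
  assumes "of_int n \<le> x" "x < of_int n + \<delta>" "\<delta> \<le> 1"
  shows "frac x < \<delta>"
proof -
  have "\<lfloor>x\<rfloor> = n" using assms by linarith
  then show ?thesis using assms by (simp add: frac_def)
qed

lemma not_arrow_by_frac_colouring:
  fixes \<alpha> \<sigma> \<delta> :: real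
  assumes far: "\<And>n::int. \<bar>2 * \<sigma> - of_int n\<bar> \<ge> 2 * \<delta>"
    and hit: "\<And>b c. \<exists>i<m. frac (\<sigma> * \<alpha>\<^sup>2 * (real i)\<^sup>2 + b * real i + c) < \<delta>"
  shows "not_arrow (ell_copies 1 3 :: (real ^ 'n) set set) (ell_copies \<alpha> m)"
proof -
  define col :: "real ^ 'n \<Rightarrow> colour"
    where "col x = (if frac (\<sigma> * (x \<bullet> x)) < \<delta> then Red else Blue)" for x
  have no_red: False if S_in: "S \<in> ell_copies 1 3" and red: "\<forall>x\<in>S. col x = Red" for S
  proof -
    obtain x u where S: "S = (\<lambda>i. x + (real i * 1) *\<^sub>R u) ` {..<3}" and u: "norm u = 1"
      using S_in unfolding ell_copies_def by blast
    have uu: "u \<bullet> u = 1" using u by (simp add: dot_square_norm)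
    define p where "p i = \<sigma> * ((x + real i *\<^sub>R u) \<bullet> (x + real i *\<^sub>R u))" for i :: nat
    have small: "0 \<le> p i - of_int \<lfloor>p i\<rfloor> \<and> p i - of_int \<lfloor>p i\<rfloor> < \<delta>" if "i < 3" for i
    proof -
      have "x + real i *\<^sub>R u \<in> S" using S that by auto
      then have "col (x + real i *\<^sub>R u) = Red" using red by blast
      then have "frac (p i) < \<delta>"
        unfolding col_def p_def by (auto split: if_splits)
      then show ?thesis by (simp add: frac_def)
    qed
    have "p 0 + p 2 - 2 * p 1 = 2 * \<sigma>"
      unfolding p_def by (simp add: inner_add_left inner_add_right uu inner_commute algebra_simps)
    \<comment> \<open>The three fractional parts lie in [0, \<delta>), so their second difference
      lies strictly between -2 \<delta> and 2 \<delta>; the floors contribute an integer.\<close>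
    then have "\<bar>2 * \<sigma> - of_int (\<lfloor>p 0\<rfloor> + \<lfloor>p 2\<rfloor> - 2 * \<lfloor>p 1\<rfloor>)\<bar> < 2 * \<delta>"
      using small[of 0] small[of 1] small[of 2] by simp linarith
    then show False using far[of "\<lfloor>p 0\<rfloor> + \<lfloor>p 2\<rfloor> - 2 * \<lfloor>p 1\<rfloor>"] by linarith
  qed
  have no_blue: False if S_in: "S \<in> ell_copies \<alpha> m" and blue: "\<forall>x\<in>S. col x = Blue" for S
  proof -
    obtain x u where S: "S = (\<lambda>i. x + (real i * \<alpha>) *\<^sub>R u) ` {..<m}" and u: "norm u = 1"
      using S_in unfolding ell_copies_def by blast
    have uu: "u \<bullet> u = 1" using u by (simp add: dot_square_norm)
    obtain i where i: "i < m"
      "frac (\<sigma> * \<alpha>\<^sup>2 * (real i)\<^sup>2 + (2 * \<sigma> * \<alpha> * (x \<bullet> u)) * real i + \<sigma> * (x \<bullet> x)) < \<delta>"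
      using hit by blast
    let ?y = "x + (real i * \<alpha>) *\<^sub>R u"
    have "\<sigma> * (?y \<bullet> ?y) =
        \<sigma> * \<alpha>\<^sup>2 * (real i)\<^sup>2 + (2 * \<sigma> * \<alpha> * (x \<bullet> u)) * real i + \<sigma> * (x \<bullet> x)"
      by (simp add: inner_add_left inner_add_right uu inner_commute[of u x] algebra_simps power2_eq_square)
    then have "col ?y = Red" unfolding col_def using i(2) by simp
    moreover have "?y \<in> S" using S i(1) by auto
    ultimately show False using blue by force
  qed
  show ?thesis unfolding not_arrow_def using no_red no_blue by blast
qed

section \<open>Diophantine approximation and linear sequences modulo 1\<close>

lemma Dirichlet_approx_5:
  fixes B :: real
  obtains J :: nat and e :: int where "1 \<le> J" "J \<le> 5" "\<bar>real J * B - of_int e\<bar> \<le> 1/6"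
proof -
  define f where "f = frac B"
  have f: "0 \<le> f" "f < 1" unfolding f_def by (auto simp: frac_lt_1)
  have B: "B = of_int \<lfloor>B\<rfloor> + f" unfolding f_def by (simp add: frac_def)
  have "\<exists>J::nat. \<exists>d::int. 1 \<le> J \<and> J \<le> 5 \<and> \<bar>real J * f - of_int d\<bar> \<le> 1/6"
  proof -
    \<comment> \<open>The centres \<open>d / J\<close> are the Farey fractions of order 5 in
      increasing order. Neighbours with denominators J and J' are 1/(J J') apart and J + J' is at
      least 6, so the intervals of radius 1/(6 J) around them cover [0, 1].\<close>
    have "\<bar>1*f-0\<bar> \<le> 1/6 \<or> \<bar>5*f-1\<bar> \<le> 1/6 \<or> \<bar>4*f-1\<bar> \<le> 1/6 \<or> \<bar>3*f-1\<bar> \<le> 1/6 \<or> \<bar>5*f-2\<bar> \<le> 1/6 \<or>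
      \<bar>2*f-1\<bar> \<le> 1/6 \<or> \<bar>5*f-3\<bar> \<le> 1/6 \<or> \<bar>3*f-2\<bar> \<le> 1/6 \<or> \<bar>4*f-3\<bar> \<le> 1/6 \<or> \<bar>5*f-4\<bar> \<le> 1/6 \<or> \<bar>1*f-1\<bar> \<le> 1/6"
      using f by argo
    then show ?thesis
      by (elim disjE; force intro: exI[of _ "1::nat"] exI[of _ "2::nat"] exI[of _ "3::nat"]
           exI[of _ "4::nat"] exI[of _ "5::nat"] exI[of _ "0::int"] exI[of _ "1::int"]
           exI[of _ "2::int"] exI[of _ "3::int"] exI[of _ "4::int"])
  qed
  then obtain J :: nat and d :: int where J: "1 \<le> J" "J \<le> 5" "\<bar>real J * f - of_int d\<bar> \<le> 1/6"
    by blast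
  have "real J * B - of_int (int J * \<lfloor>B\<rfloor> + d) = real J * f - of_int d"
    by (subst B) (simp add: algebra_simps)
  then have "\<bar>real J * B - of_int (int J * \<lfloor>B\<rfloor> + d)\<bar> \<le> 1/6" using J(3) by argo
  then show ?thesis using that J by blast
qed

text \<open>In \<open>n\<close> steps the sequence travels a distance of at least 1, so it passes an
  integer, and a step of length at most \<delta> cannot jump over the window of length \<delta>
  above that integer.\<close>

lemma ex_frac_linear_less:
  fixes D c \<delta> :: real
  assumes "1 / real n \<le> \<bar>D\<bar>" "\<bar>D\<bar> \<le> \<delta>" "\<delta> \<le> 1" "n > 0"
  shows "\<exists>j\<le>n. frac (D * real j + c) < \<delta>"
proof -
  have nD: "1 \<le> real n * \<bar>D\<bar>" using assms by (simp add: field_simps)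
  have D0: "\<bar>D\<bar> > 0" using assms by (metis divide_pos_pos less_le_trans of_nat_0_less_iff zero_less_one)
  show ?thesis
  proof (cases "D > 0")
    case True
    define r where "r = (of_int \<lceil>c\<rceil> - c) / D"
    have r: "r * D = of_int \<lceil>c\<rceil> - c" using True by (simp add: r_def)
    have "r \<ge> 0" using True by (simp add: r_def)
    have "r * D \<le> real n * D" using nD True r by linarith
    then have rn: "r \<le> real n" using True by simp
    define j where "j = nat \<lceil>r\<rceil>"
    have j: "real j \<ge> r" "real j < r + 1" using \<open>r \<ge> 0\<close> unfolding j_def by linarith+
    have "r * D \<le> real j * D" "real j * D < (r + 1) * D"
      using j True by (auto intro: mult_right_mono mult_strict_right_mono)
    then have "of_int \<lceil>c\<rceil> \<le> D * real j + c" "D * real j + c < of_int \<lceil>c\<rceil> + \<delta>"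
      using r True assms(2) unfolding mult.commute[of D] distrib_right by linarith+
    moreover have "j \<le> n" using rn unfolding j_def by linarith
    ultimately show ?thesis using frac_less_if_near_int assms(3) by blast
  next
    case False
    then have E: "\<bar>D\<bar> = - D" by simp
    define r where "r = (c - of_int \<lfloor>c\<rfloor>) / (- D)"
    have r: "r * (- D) = c - of_int \<lfloor>c\<rfloor>" using D0 by (simp add: r_def)
    have "r \<ge> 0" using D0 E unfolding r_def by (intro divide_nonneg_nonneg) linarith+
    have "r * (- D) \<le> real n * (- D)"
      using nD r frac_lt_1[of c] unfolding E frac_def by linarith
    then have rn: "r \<le> real n" using D0 E by simp
    \<comment> \<open>The sequence now descends: rounding down picks the last term that is still at
      or above the floor of \<open>c\<close>.\<close>
    define j where "j = nat \<lfloor>r\<rfloor>"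
    have j: "real j \<le> r" "real j > r - 1" using \<open>r \<ge> 0\<close> unfolding j_def by linarith+
    have "real j * (- D) \<le> r * (- D)" "(r - 1) * (- D) < real j * (- D)"
      using j D0 E by (intro mult_right_mono mult_strict_right_mono; linarith)+
    then have "of_int \<lfloor>c\<rfloor> \<le> D * real j + c" "D * real j + c < of_int \<lfloor>c\<rfloor> + \<delta>"
      using r E assms(2) unfolding mult.commute[of D] left_diff_distrib mult_minus_right by linarith+
    moreover have "j \<le> n" using rn unfolding j_def by linarith
    ultimately show ?thesis using frac_less_if_near_int assms(3) by blast
  qed
qed

section \<open>Gaps between values of quadratic polynomials modulo a prime\<close>

text \<open>As \<open>c\<close> varies, the condition slides a window of \<open>G\<close>
  consecutive residues around the circle, so \<open>G\<close> bounds the cyclic gaps between the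
  values of \<open>A * s\<^sup>2\<close> modulo \<open>q\<close>.\<close>

definition square_gaps_le :: "int \<Rightarrow> int \<Rightarrow> bool" where
  "square_gaps_le q G \<longleftrightarrow> (\<forall>A c. \<not> q dvd A \<longrightarrow> (\<exists>s. (A * s\<^sup>2 + c) mod q < G))"

text \<open>Here \<open>\<nu>\<close> is a quadratic nonresidue: replacing \<open>s\<close> by \<open>t * s\<close> multiplies \<open>A\<close> by a square,
  so only the two classes \<open>A = 1\<close> and \<open>A = \<nu>\<close> need to be computed.\<close>

lemma square_gaps_leI:
  fixes q G \<nu> :: int
  assumes q: "q > 0"
    and classes: "\<forall>A\<in>set [1..q-1]. \<exists>t\<in>set [1..q-1]. (let r = A * t * t mod q in r = 1 \<or> r = \<nu>)"
    and gaps: "\<forall>c\<in>set [0..q-1]. (\<exists>s\<in>set [0..q-1]. (s * s + c) mod q < G) \<and>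
                              (\<exists>s\<in>set [0..q-1]. (\<nu> * s * s + c) mod q < G)"
  shows "square_gaps_le q G"
  unfolding square_gaps_le_def
proof (intro allI impI)
  fix A c :: int
  assume "\<not> q dvd A"
  then have "A mod q \<in> set [1..q-1]"
    using q pos_mod_bound[of q A] pos_mod_sign[of q A] by (auto simp: dvd_eq_mod_eq_0 simp del: pos_mod_sign)
  then obtain t \<mu> where t: "(A mod q) * t * t mod q = \<mu>" "\<mu> = 1 \<or> \<mu> = \<nu>"
    using classes unfolding Let_def by blast
  have At: "[A * t\<^sup>2 = \<mu>] (mod q)"
    using t(1) unfolding cong_def power2_eq_square
    by (metis mod_mod_trivial mod_mult_left_eq mult.assoc)
  have "c mod q \<in> set [0..q-1]" using q pos_mod_bound[of q c] by auto
  then obtain s where s: "(\<mu> * s * s + c mod q) mod q < G"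
    using gaps t(2) by (metis mult_1)
  have "[A * (t * s)\<^sup>2 + c = \<mu> * s\<^sup>2 + c] (mod q)"
    using cong_add[OF cong_mult[OF At cong_refl[of "s\<^sup>2"]] cong_refl[of c]]
    by (simp add: power_mult_distrib mult.assoc)
  then have "(A * (t * s)\<^sup>2 + c) mod q < G"
    using s unfolding cong_def by (simp add: power2_eq_square mult.assoc mod_add_right_eq)
  then show "\<exists>s. (A * s\<^sup>2 + c) mod q < G" by blast
qed

text \<open>For primes congruent to 3 modulo 4 the nonresidue is -1, written \<open>q - 1\<close>.
  Only 73 is congruent to 1 modulo 4, and 5 serves there.\<close>

lemma square_gaps_67: "square_gaps_le 67 7"
  by (rule square_gaps_leI[where \<nu> = 66]; code_simp)
lemma square_gaps_71: "square_gaps_le 71 7"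
  by (rule square_gaps_leI[where \<nu> = 70]; code_simp)
lemma square_gaps_73: "square_gaps_le 73 5"
  by (rule square_gaps_leI[where \<nu> = 5]; code_simp)
lemma square_gaps_79: "square_gaps_le 79 7"
  by (rule square_gaps_leI[where \<nu> = 78]; code_simp)
lemma square_gaps_83: "square_gaps_le 83 8"
  by (rule square_gaps_leI[where \<nu> = 82]; code_simp)

text \<open>Completing the square: as \<open>2 * A\<close> is invertible modulo the odd prime
  \<open>q\<close>, some \<open>h\<close> satisfies 2 A h = e modulo \<open>q\<close>, and the
  substitution s = t - h removes the linear term.\<close>

lemma square_gaps_le_quadratic:
  fixes q G A e c :: int
  assumes gaps: "square_gaps_le q G" and q: "prime q" "q > 2" and A: "\<not> q dvd A"
  shows "\<exists>s::nat. int s < q \<and> (A * (int s)\<^sup>2 + e * int s + c) mod q < G"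
proof -
  have "\<not> q dvd 2" using q by (auto dest: zdvd_imp_le)
  then have "\<not> q dvd 2 * A" using A q(1) prime_dvd_mult_iff by blast
  then have "coprime (2 * A) q" using q(1) prime_imp_coprime coprime_commute by blast
  then obtain g where "[(2 * A) * g = 1] (mod q)" using cong_solve_coprime_int by blast
  then have "[2 * A * g * e = 1 * e] (mod q)" by (rule cong_mult) simp
  then have h: "[2 * A * (g * e) = e] (mod q)" by (simp add: mult.assoc)
  define h where "h = g * e"
  obtain t where t: "(A * t\<^sup>2 + (c - A * h\<^sup>2)) mod q < G"
    using gaps A unfolding square_gaps_le_def by blast
  define s where "s = nat ((t - h) mod q)"
  have s: "int s = (t - h) mod q" using q by (simp add: s_def)
  have sc: "[int s = t - h] (mod q)" unfolding s by (simp add: cong_def)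
  have "[A * (int s)\<^sup>2 + e * int s + c = A * (t - h)\<^sup>2 + (2 * A * h) * (t - h) + c] (mod q)"
    using sc h unfolding h_def[symmetric]
    by (intro cong_add cong_mult cong_pow cong_refl) (auto simp: cong_sym)
  also have "A * (t - h)\<^sup>2 + (2 * A * h) * (t - h) + c = A * t\<^sup>2 + (c - A * h\<^sup>2)"
    by (simp add: power2_eq_square algebra_simps)
  finally have "(A * (int s)\<^sup>2 + e * int s + c) mod q < G" using t by (simp add: cong_def)
  then show ?thesis using s q by (intro exI[of _ s]) simp
qed

text \<open>Rounding \<open>c * q\<close> down to an integer reduces this to residues modulo
  \<open>q\<close>. The rounding loses less than 1 and a residue below \<open>G\<close> is at most
  \<open>G - 1\<close>, so the total stays below \<open>G\<close>, hence below
  \<open>\<delta> * q\<close>.\<close>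

lemma ex_frac_quadratic_mod_less:
  fixes q G A e :: int and c \<delta> :: real
  assumes gaps: "square_gaps_le q G" and q: "prime q" "q > 2" and A: "\<not> q dvd A"
    and \<delta>: "of_int G \<le> \<delta> * of_int q" "\<delta> \<le> 1"
  obtains s :: nat and n :: int where "int s < q"
    "of_int n \<le> of_int (A * (int s)\<^sup>2 + e * int s) / of_int q + c"
    "of_int (A * (int s)\<^sup>2 + e * int s) / of_int q + c < of_int n + \<delta>"
proof -
  define k where "k = \<lfloor>c * of_int q\<rfloor>"
  obtain s :: nat where s: "int s < q" "(A * (int s)\<^sup>2 + e * int s + k) mod q < G"
    using square_gaps_le_quadratic[OF gaps q A] by blast
  define V where "V = A * (int s)\<^sup>2 + e * int s"
  define n where "n = (V + k) div q"
  define r where "r = (V + k) mod q"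
  have V: "V + k = n * q + r" by (simp add: n_def r_def)
  have r: "0 \<le> r" "r + 1 \<le> G" using s q unfolding r_def V_def by auto
  have qp: "(0::real) < of_int q" using q by simp
  have k: "of_int k \<le> c * of_int q" "c * of_int q < of_int k + 1" unfolding k_def by linarith+
  have V': "of_int V + of_int k = of_int n * of_int q + (of_int r::real)"
    using V by (metis of_int_add of_int_mult)
  have r': "(0::real) \<le> of_int r" "of_int r + 1 \<le> (of_int G::real)"
    using r by linarith+
  have "of_int n * of_int q \<le> of_int V + c * of_int q" using k V' r' by linarith
  then have 1: "of_int n \<le> of_int V / of_int q + c" using qp by (simp add: field_simps)
  have "of_int V + c * of_int q < of_int n * of_int q + \<delta> * of_int q"
    using k V' r' \<delta> by linarith
  then have 2: "of_int V / of_int q + c < of_int n + \<delta>" using qp by (simp add: field_simps)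
  show ?thesis using that[of s n] s 1 2 unfolding V_def by blast
qed

section \<open>Quadratic polynomials with real lower coefficients modulo 1\<close>

text \<open>The assumption \<open>G\<close> says G/q + 1/n \<le> 1/6: the gap modulo
  \<open>q\<close> and the error from \<open>D\<close> fit together into the window. The bound on
  \<open>m\<close> leaves room for the largest index, \<open>q * J * j\<close> with
  \<open>J \<le> 5\<close> and \<open>j \<le> n\<close>.\<close>

lemma ex_frac_quadratic_less:
  fixes q n G m :: nat and a :: int and b c :: real
  assumes q: "prime q" "q > 5" and gaps: "square_gaps_le (int q) (int G)"
    and G: "6 * G * n + 6 * q \<le> q * n" and m: "5 * q * n < m" and n: "n > 0"
    and a: "\<not> int q dvd a"
  shows "\<exists>i<m. frac (of_int a / real q * (real i)\<^sup>2 + b * real i + c) < 1/6"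
proof -
  obtain J e where J: "1 \<le> J" "J \<le> 5" and JB: "\<bar>real J * (b * real q) - of_int e\<bar> \<le> 1/6"
    using Dirichlet_approx_5 by metis
  define D where "D = real J * (b * real q) - of_int e"
  have qp: "real q > 0" using q by simp
  show ?thesis
  proof (cases "1 / real n \<le> \<bar>D\<bar>")
    case True
    then obtain j where j: "j \<le> n" "frac (D * real j + c) < 1/6"
      using ex_frac_linear_less[of n D "1/6" c] JB n unfolding D_def by auto
    \<comment> \<open>The factor \<open>q\<close> makes the quadratic term an integer, and
      \<open>b * i\<close> equals (e + D) j, so only \<open>D * j + c\<close> remains modulo
      1.\<close>
    define i where "i = q * J * j"
    have "of_int a / real q * (real i)\<^sup>2 + b * real i + c =
        D * real j + c + of_int (a * int q * (int J)\<^sup>2 * (int j)\<^sup>2 + e * int j)"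
      using qp unfolding i_def D_def by (simp add: power2_eq_square field_simps)
    then have "frac (of_int a / real q * (real i)\<^sup>2 + b * real i + c) < 1/6"
      using j by (simp only: frac_add_of_int_right)
    moreover have "i < m"
    proof -
      have "q * J * j \<le> q * 5 * n" using J j by (intro mult_le_mono) auto
      also have "\<dots> < m" using m by (simp only: mult.commute[of q])
      finally show ?thesis unfolding i_def .
    qed
    ultimately show ?thesis by blast
  next
    case False
    \<comment> \<open>The part 1/n of the window is reserved for the drift.\<close>
    define \<delta> where "\<delta> = 1/6 - 1 / real n"
    have D: "\<bar>D\<bar> < 1 / real n" using False by simp
    have "real (6 * G * n + 6 * q) \<le> real (q * n)" using G by (simp only: of_nat_le_iff)
    then have \<delta>: "real G \<le> \<delta> * real q" using n unfolding \<delta>_def by (simp add: field_simps)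
    have \<delta>': "of_int (int G) \<le> \<delta> * of_int (int q)" "\<delta> \<le> 1"
    proof -
      have "1 / real n \<ge> 0" by simp
      then show "\<delta> \<le> 1" unfolding \<delta>_def by linarith
    qed (use \<delta> in simp)
    have pq: "prime (int q)" and q2: "int q > 2" using q by simp_all
    have "\<not> int q dvd int J" using J q by (auto dest: dvd_imp_le)
    then have A: "\<not> int q dvd a * (int J)\<^sup>2"
      using a pq by (simp add: prime_dvd_mult_iff prime_dvd_power_iff)
    \<comment> \<open>The drift \<open>D * s / q\<close> has the sign of \<open>D\<close>; the shift \<open>w\<close> makes it nonnegative.\<close>
    define w where "w = (if D \<ge> 0 then 0 else 1 / real n)"
    obtain s :: nat and k :: int where s: "int s < int q"
      "of_int k \<le> of_int (a * (int J)\<^sup>2 * (int s)\<^sup>2 + e * int s) / of_int (int q) + (c - w)"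
      "of_int (a * (int J)\<^sup>2 * (int s)\<^sup>2 + e * int s) / of_int (int q) + (c - w) < of_int k + \<delta>"
      using ex_frac_quadratic_mod_less[OF gaps pq q2 A \<delta>', of e "c - w"] by blast
    define i where "i = J * s"
    have f: "of_int a / real q * (real i)\<^sup>2 + b * real i + c =
       of_int (a * (int J)\<^sup>2 * (int s)\<^sup>2 + e * int s) / of_int (int q) + c + D * (real s / real q)"
      using qp unfolding i_def D_def by (simp add: power2_eq_square field_simps)
    define x where "x = real s / real q"
    have x: "0 \<le> x" "x \<le> 1" using s(1) qp unfolding x_def by auto
    have Dx: "0 \<le> D * x + w" "D * x + w \<le> 1 / real n"
    proof -
      have *: "\<bar>D * x\<bar> \<le> \<bar>D\<bar>" using x by (simp add: abs_mult mult_left_le)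
      have "D \<ge> 0 \<Longrightarrow> D * x \<ge> 0" "D < 0 \<Longrightarrow> D * x \<le> 0"
        using x by (auto simp: mult_nonpos_nonneg)
      then show "0 \<le> D * x + w" "D * x + w \<le> 1 / real n"
        using * D unfolding w_def by (auto split: if_splits)
    qed
    have "frac (of_int a / real q * (real i)\<^sup>2 + b * real i + c) < 1/6"
    proof (rule frac_less_if_near_int[where n = k])
      show "of_int k \<le> of_int a / real q * (real i)\<^sup>2 + b * real i + c"
        unfolding f x_def[symmetric] using s(2) Dx by linarith
      show "of_int a / real q * (real i)\<^sup>2 + b * real i + c < of_int k + 1/6"
        unfolding f x_def[symmetric] using s(3) Dx unfolding \<delta>_def by linarith
    qed simp
    moreover have "i < m"
    proof -
      have "J * s \<le> 5 * q" using J s(1) by (intro mult_le_mono) auto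
      also have "\<dots> \<le> 5 * q * n" using n by simp
      finally show ?thesis using m by (simp add: i_def)
    qed
    ultimately show ?thesis by blast
  qed
qed

section \<open>Choice of the leading coefficient\<close>

text \<open>Otherwise every \<open>2 ^ k * y\<close> is within 1/3 of an integer \<open>N k\<close>.
  Then \<open>N (Suc k)\<close> and \<open>2 * N k\<close> differ by less than 2/3 + 1/3 = 1, hence
  agree, so the distance from \<open>y\<close> to \<open>N 0\<close> can be doubled forever while
  staying below 1/3.\<close>

lemma doubling_far_from_Ints:
  fixes y :: real
  assumes "y \<notin> \<int>"
  obtains k :: nat where "\<And>n::int. \<bar>2 ^ k * y - of_int n\<bar> \<ge> 1/3"
proof (rule ccontr)
  assume "\<not> thesis"
  then have "\<forall>k. \<exists>n::int. \<bar>2 ^ k * y - of_int n\<bar> < 1/3" using that by (meson not_le)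
  then obtain N :: "nat \<Rightarrow> int" where N: "\<bar>2 ^ k * y - of_int (N k)\<bar> < 1/3" for k by metis
  have step: "N (Suc k) = 2 * N k" for k
  proof -
    have "\<bar>of_int (N (Suc k) - 2 * N k) :: real\<bar> < 1"
      using N[of k] N[of "Suc k"] unfolding power_Suc mult.assoc of_int_diff of_int_mult by simp argo
    then show ?thesis by linarith
  qed
  have Nk: "N k = 2 ^ k * N 0" for k by (induction k) (auto simp: step)
  have bound: "2 ^ k * \<bar>y - of_int (N 0)\<bar> < 1/3" for k
  proof -
    have "2 ^ k * y - of_int (N k) = 2 ^ k * (y - of_int (N 0))"
      unfolding Nk[of k] by (simp add: algebra_simps)
    then show ?thesis using N[of k] by (simp add: abs_mult)
  qed
  have ne: "\<bar>y - of_int (N 0)\<bar> > 0" using assms by (metis Ints_of_int eq_iff_diff_eq_0 zero_less_abs_iff)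
  obtain k where "1 / \<bar>y - of_int (N 0)\<bar> < 2 ^ k"
    using real_arch_pow[of 2] by auto
  then have "1 < 2 ^ k * \<bar>y - of_int (N 0)\<bar>" using ne by (simp add: field_simps)
  then show False using bound[of k] by linarith
qed

lemma ex_frac_quadratic_less_6889:
  fixes q :: nat and a :: int and b c :: real
  assumes "q \<in> {67, 71, 73, 79, 83}" "\<not> int q dvd a"
  shows "\<exists>i<6889. frac (of_int a / real q * (real i)\<^sup>2 + b * real i + c) < 1/6"
proof -
  have "prime (67::nat)" "prime (71::nat)" "prime (73::nat)" "prime (79::nat)" "prime (83::nat)"
    by simp_all
  \<comment> \<open>For each \<open>q\<close> the value of \<open>n\<close> is the largest with
    \<open>5 * q * n < 6889\<close>.\<close>
  then show ?thesis
    using assms ex_frac_quadratic_less[of 67 7 20 6889 a b c] ex_frac_quadratic_less[of 71 7 19 6889 a b c]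
      ex_frac_quadratic_less[of 73 5 18 6889 a b c] ex_frac_quadratic_less[of 79 7 17 6889 a b c]
      ex_frac_quadratic_less[of 83 8 16 6889 a b c]
      square_gaps_67 square_gaps_71 square_gaps_73 square_gaps_79 square_gaps_83
    by auto
qed

theorem theorem1p3:
  fixes \<alpha> :: real
  assumes "\<alpha> > 0"
  shows "not_arrow (ell_copies 1 3 :: (real ^ 'n) set set) (ell_copies \<alpha> 6889)"
proof (cases "\<exists>q\<in>{67, 71, 73, 79, 83::nat}. 2 / (\<alpha>\<^sup>2 * real q) \<notin> \<int>")
  case True
  then obtain q :: nat where q: "q \<in> {67, 71, 73, 79, 83}" and "2 / (\<alpha>\<^sup>2 * real q) \<notin> \<int>" by blast
  then obtain k :: nat where k: "\<And>n::int. \<bar>2 ^ k * (2 / (\<alpha>\<^sup>2 * real q)) - of_int n\<bar> \<ge> 1/3"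
    using doubling_far_from_Ints by blast
  have nd: "\<not> int q dvd 2 ^ k"
  proof -
    have "prime (int q)" using q by auto
    moreover have "\<not> int q dvd 2" using q by auto
    ultimately show ?thesis using prime_dvd_power by blast
  qed
  define \<sigma> where "\<sigma> = 2 ^ k / (\<alpha>\<^sup>2 * real q)"
  have \<sigma>: "\<sigma> * \<alpha>\<^sup>2 = of_int (2 ^ k) / real q" using assms unfolding \<sigma>_def by simp
  show ?thesis
  proof (rule not_arrow_by_frac_colouring[where \<sigma> = \<sigma> and \<delta> = "1/6"])
    show "\<bar>2 * \<sigma> - of_int n\<bar> \<ge> 2 * (1/6)" for n :: int
      using k[of n] unfolding \<sigma>_def by (simp add: mult.commute)
    show "\<exists>i<6889. frac (\<sigma> * \<alpha>\<^sup>2 * (real i)\<^sup>2 + b * real i + c) < 1/6" for b c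
      unfolding \<sigma> using ex_frac_quadratic_less_6889[OF q nd] .
  qed
next
  case False
  have int_quot: "\<exists>N::int. 2 / \<alpha>\<^sup>2 = real_of_int N * real q" if "q \<in> {67, 71, 73, 79, 83}" for q :: nat
  proof -
    have "2 / (\<alpha>\<^sup>2 * real q) \<in> \<int>" using False that by blast
    then obtain N :: int where "2 / (\<alpha>\<^sup>2 * real q) = of_int N" by (auto elim: Ints_cases)
    then show ?thesis using that assms by (intro exI[of _ N]) (auto simp: field_simps)
  qed
  obtain M :: int where M: "2 / \<alpha>\<^sup>2 = real_of_int M * 83" using int_quot[of 83] by auto
  define N where "N = M * 83"
  have N: "2 / \<alpha>\<^sup>2 = real_of_int N" using M by (simp add: N_def)
  have dvd: "int q dvd N" if "q \<in> {67, 71, 73, 79, 83}" for q :: nat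
  proof -
    obtain K :: int where "real_of_int N = real_of_int (K * int q)"
      using int_quot[OF \<open>q \<in> _\<close>] N by auto
    then have "N = K * int q" by (simp only: of_int_eq_iff)
    then show ?thesis by simp
  qed
  have "67 dvd N" "71 dvd N" "73 dvd N" "79 dvd N" "83 dvd N"
    using dvd[of 67] dvd[of 71] dvd[of 73] dvd[of 79] dvd[of 83] by simp_all
  then have "67 * 71 * 73 * 79 * 83 dvd N"
    by (intro divides_mult) (simp_all add: coprime_iff_gcd_eq_1 gcd_non_0_int)
  moreover have "N > 0" using N assms by (metis divide_pos_pos of_int_0_less_iff zero_less_numeral zero_less_power)
  ultimately have "67 * 71 * 73 * 79 * 83 \<le> N" by (rule zdvd_imp_le)
  then have Nbig: "real_of_int N \<ge> 67 * 71 * 73 * 79 * 83" by simp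
  \<comment> \<open>Since \<open>M / 2 * \<alpha>\<^sup>2\<close> is 1/83, the first summand gives
    the fraction 1/83. The second makes 2 \<sigma> a half-integer, as far from the integers as
    possible.\<close>
  define \<sigma> where "\<sigma> = real_of_int M / 2 + 1/4"
  have \<sigma>: "\<sigma> * \<alpha>\<^sup>2 = of_int 1 / real 83 + 1 / (2 * real_of_int N)"
  proof -
    have *: "\<alpha>\<^sup>2 = 2 / real_of_int N" using N assms by (metis divide_divide_eq_right nonzero_mult_div_cancel_left divide_eq_0_iff mult.commute zero_neq_numeral power_not_zero less_irrefl)
    show ?thesis using \<open>N > 0\<close> unfolding * \<sigma>_def N_def by (simp add: field_simps)
  qed
  show ?thesis
  proof (rule not_arrow_by_frac_colouring[where \<sigma> = \<sigma> and \<delta> = "1/4"])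
    show "\<bar>2 * \<sigma> - of_int n\<bar> \<ge> 2 * (1/4)" for n :: int
    proof -
      have "M - n \<ge> 0 \<or> M - n \<le> -1" by linarith
      then have "real_of_int (M - n) \<ge> 0 \<or> real_of_int (M - n) \<le> -1" by linarith
      then show ?thesis unfolding \<sigma>_def of_int_diff by argo
    qed
    show "\<exists>i<6889. frac (\<sigma> * \<alpha>\<^sup>2 * (real i)\<^sup>2 + b * real i + c) < 1/4" for b c
    proof -
      obtain i where i: "i < 6889" "frac (of_int 1 / real 83 * (real i)\<^sup>2 + b * real i + c) < 1/6"
        using ex_frac_quadratic_less_6889[of 83 1 b c] by auto
      define F where "F = of_int 1 / real 83 * (real i)\<^sup>2 + b * real i + c"
      \<comment> \<open>The error is nonnegative and at most 1/12, so it only moves the value up,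
        from a window of length 1/6 into one of length 1/6 + 1/12 = 1/4.\<close>
      define \<epsilon> where "\<epsilon> = (real i)\<^sup>2 / (2 * real_of_int N)"
      have "(real i)\<^sup>2 \<le> 6888\<^sup>2" using i(1) by (intro power_mono) auto
      then have "\<epsilon> \<le> 6888\<^sup>2 / (2 * (67 * 71 * 73 * 79 * 83))"
        unfolding \<epsilon>_def using Nbig by (intro frac_le) auto
      then have \<epsilon>: "\<epsilon> \<le> 1/12" by simp
      have "\<epsilon> \<ge> 0" unfolding \<epsilon>_def using \<open>N > 0\<close> by simp
      have "F < of_int \<lfloor>F\<rfloor> + 1/6" using i(2) unfolding F_def[symmetric] frac_def by linarith
      then have "frac (F + \<epsilon>) < 1/4"
        using \<epsilon> \<open>\<epsilon> \<ge> 0\<close> of_int_floor_le[of F]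
        by (intro frac_less_if_near_int[where n = "\<lfloor>F\<rfloor>"]; linarith)
      moreover have "\<sigma> * \<alpha>\<^sup>2 * (real i)\<^sup>2 + b * real i + c = F + \<epsilon>"
        unfolding \<sigma> F_def \<epsilon>_def by (simp add: algebra_simps)
      ultimately show ?thesis using i(1) by metis
    qed
  qed
qed

end
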